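(* Let $0 < R \leq \infty$, $I = (0,R)$, and $f: I \rightarrow \mathbb{R}$. Then the following are equivalent: \begin{enumerate} \item For all $n \geq 1$, $f[a {\bf 1}_{n \times n} + u u^T] \in \mathbb{P}_n$ for every $a \in [0,R)$ and $u \in \mathbb{R}^n$ such that $a + u_iu_j \in I$ for all $i,j$. \item For all $n \geq 1$, $f[A] \in \mathbb{P}_n$ for every $A \in \mathbb{P}_n(I)$. \item The function $f$ is absolutely monotonic on $I$. \end{enumerate}
   Context: $\mathbb{P}_n(J)$ is the set of $n \times n$ real symmetric positive semidefinite matrices with entries in $J \subset \mathbb{R}$, and $\mathbb{P}_n := \mathbb{P}_n(\mathbb{R})$. ${\bf 1}_{n \times n}$ is the $n\times n$ matrix with all entries equal to $1$. For a matrix $A=(a_{ij})$ with entries in the domain of $f$, $f[A] := (f(a_{ij}))$ (entrywise application). For an interval $I$ with interior $I^\circ$, a continuous function $f: I \to \mathbb{R}$ is absolutely monotonic on $I$ if $f \in C^\infty(I^\circ)$ and $f^{(k)}(x) \geq 0$ for all $x \in I^\circ$ and all integers $k \geq 0$. *)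

theory Defs
  imports
    "HOL-Analysis.Derivative"
    "HOL-Library.Extended_Real"
    "Jordan_Normal_Form.Matrix"
begin

definition psd_mats :: "nat \<Rightarrow> real set \<Rightarrow> real mat set" where
  "psd_mats n J = {A \<in> carrier_mat n n.
     transpose_mat A = A \<and>
     (\<forall>x \<in> carrier_vec n. scalar_prod x (A *\<^sub>v x) \<ge> 0) \<and>
     elements_mat A \<subseteq> J}"

definition ones_mat :: "nat \<Rightarrow> real mat" where
  "ones_mat n = mat n n (\<lambda>_. 1)"

definition outer_self :: "real vec \<Rightarrow> real mat" where
  "outer_self u = mat_of_cols (dim_vec u) [u] * transpose_mat (mat_of_cols (dim_vec u) [u])"

text \<open>\<open>S\<close> is meant to be open. Since \<open>deriv\<close> is total, smoothness has to be expressed by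
  requiring every iterated derivative to be differentiable. All of this depends only on the
  values of the function near points of \<open>S\<close>, so a total function may represent one defined
  on an interval only.\<close>

definition smooth_on_open :: "real set \<Rightarrow> (real \<Rightarrow> real) \<Rightarrow> bool" where
  "smooth_on_open S f \<longleftrightarrow> (\<forall>k. \<forall>x \<in> S. (deriv ^^ k) f field_differentiable at x)"

definition absolutely_monotonic_on :: "real set \<Rightarrow> (real \<Rightarrow> real) \<Rightarrow> bool" where
  "absolutely_monotonic_on I f \<longleftrightarrow>
     continuous_on I f \<and>
     smooth_on_open (interior I) f \<and>
     (\<forall>k. \<forall>x \<in> interior I. (deriv ^^ k) f x \<ge> 0)"

end

theory Submission
  imports Defs "HOL-Complex_Analysis.Great_Picard"
begin

unbundle no vec_syntax

text \<open>All three conditions are equivalent to a fourth one: up to any point of \<open>I\<close>, the function is a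
power series with nonnegative coefficients (\<open>local_power_series_on\<close>). Such a series can be
differentiated term by term, so the function is absolutely monotonic (\<open>power_series_higher_derivs\<close>);
it also preserves positivity, since entrywise powers of a positive semidefinite matrix are positive
semidefinite by the Schur product theorem (\<open>psd_form_power_series\<close>). The matrices of the rank-one
condition are themselves positive semidefinite, so the first condition is the weakest of the matrix
conditions, and the power series has to be derived from it and from absolute monotonicity.

The series comes from nonnegative forward differences \<open>\<Delta>\<^sub>h\<^sup>m f\<close>. They are the coefficients, up to binomial
factors, of the Bernstein polynomials of \<open>f\<close> in the monomial basis. Hence \<open>f\<close> is a pointwise limit of
polynomials with nonnegative coefficients; these coefficients are bounded, so a subsequence converges
coefficientwise and the limit may be taken inside the sum (\<open>fdiff_nonneg_imp_power_series\<close>). For an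
absolutely monotonic function the forward differences are nonnegative because a function with
nonnegative derivative is nondecreasing.

It remains to derive nonnegative forward differences from the rank-one condition. Matrices of size
one and two already show that \<open>f\<close> is nonnegative, nondecreasing and continuous. Suppose first that \<open>f\<close> is smooth.
Expand \<open>\<Sum>\<^sub>i\<^sub>,\<^sub>j x\<^sub>i x\<^sub>j f (a + t\<^sup>2 w\<^sub>i w\<^sub>j)\<close> in powers of \<open>t\<^sup>2\<close>: the \<open>k\<close>-th coefficient
is the \<open>k\<close>-th derivative at \<open>a\<close> times \<open>(\<Sum>\<^sub>i x\<^sub>i w\<^sub>i\<^sup>k)\<^sup>2\<close>, up to a factorial. Choosing \<open>x\<close> orthogonal to
the powers of \<open>w\<close> below the \<open>m\<close>-th and letting \<open>t\<close> tend to \<open>0\<close> gives a nonnegative \<open>m\<close>-th derivative.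
For general \<open>f\<close> the argument is applied to its \<open>m\<close>-fold Steklov integral, where one step takes \<open>g\<close> to
the function whose value at \<open>x\<close> is the integral of \<open>g\<close> over \<open>[x, x + h]\<close>. This is an integral of
translates of \<open>g\<close>, and translating only increases the parameter \<open>a\<close>, so the rank-one condition survives on a
slightly shorter interval. Each step gains a derivative, and the \<open>m\<close>-th derivative of the \<open>m\<close>-fold integral
is exactly \<open>\<Delta>\<^sub>h\<^sup>m f\<close>, with no limit in \<open>h\<close> to take.\<close>

section \<open>Positive semidefinite forms and the Schur product\<close>

text \<open>Forms are indexed by an arbitrary set rather than by \<open>{..<n}\<close>, so that rows can be removed one at a
time in the induction behind the Schur product.\<close>
definition psd_form :: "'a set \<Rightarrow> ('a \<Rightarrow> 'a \<Rightarrow> real) \<Rightarrow> bool" where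
  "psd_form S A \<longleftrightarrow>
     (\<forall>i\<in>S. \<forall>j\<in>S. A i j = A j i) \<and> (\<forall>x. 0 \<le> (\<Sum>i\<in>S. \<Sum>j\<in>S. x i * x j * A i j))"

lemma psd_formD: "psd_form S A \<Longrightarrow> 0 \<le> (\<Sum>i\<in>S. \<Sum>j\<in>S. x i * x j * A i j)"
  by (simp add: psd_form_def)

lemma psd_form_sym: "psd_form S A \<Longrightarrow> i \<in> S \<Longrightarrow> j \<in> S \<Longrightarrow> A i j = A j i"
  by (simp add: psd_form_def)

lemma psd_formI:
  assumes "\<And>i j. i \<in> S \<Longrightarrow> j \<in> S \<Longrightarrow> A i j = A j i"
    and "\<And>x. 0 \<le> (\<Sum>i\<in>S. \<Sum>j\<in>S. x i * x j * A i j)"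
  shows "psd_form S A"
  using assms by (simp add: psd_form_def)

lemma psd_form_cong:
  assumes "\<And>i j. i \<in> S \<Longrightarrow> j \<in> S \<Longrightarrow> A i j = B i j"
  shows "psd_form S A \<longleftrightarrow> psd_form S B"
proof -
  have "(\<Sum>i\<in>S. \<Sum>j\<in>S. x i * x j * A i j) = (\<Sum>i\<in>S. \<Sum>j\<in>S. x i * x j * B i j)" for x
    using assms by (intro sum.cong refl) simp
  then show ?thesis
    using assms by (simp add: psd_form_def)
qed

lemma quadratic_form_insert:
  fixes A :: "'a \<Rightarrow> 'a \<Rightarrow> real"
  assumes "finite S" "s \<notin> S" and sym: "\<And>j. j \<in> S \<Longrightarrow> A j s = A s j"
  shows "(\<Sum>i\<in>insert s S. \<Sum>j\<in>insert s S. x i * x j * A i j) =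
    (x s)\<^sup>2 * A s s + 2 * x s * (\<Sum>j\<in>S. x j * A s j) + (\<Sum>i\<in>S. \<Sum>j\<in>S. x i * x j * A i j)"
proof -
  have "(\<Sum>i\<in>S. x i * x s * A i s) = x s * (\<Sum>j\<in>S. x j * A s j)"
    unfolding sum_distrib_left by (rule sum.cong) (auto simp: sym)
  moreover have "(\<Sum>j\<in>S. x s * x j * A s j) = x s * (\<Sum>j\<in>S. x j * A s j)"
    by (simp add: sum_distrib_left mult.assoc)
  ultimately show ?thesis
    using assms(1,2) by (simp add: sum.distrib power2_eq_square algebra_simps)
qed

lemma psd_form_subset:
  assumes "psd_form T A" "S \<subseteq> T" "finite T"
  shows "psd_form S A"
proof (rule psd_formI)
  show "A i j = A j i" if "i \<in> S" "j \<in> S" for i j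
    using assms that by (intro psd_form_sym[OF assms(1)]) auto
  fix x :: "'a \<Rightarrow> real"
  let ?y = "\<lambda>i. if i \<in> S then x i else 0"
  have "0 \<le> (\<Sum>i\<in>T. \<Sum>j\<in>T. ?y i * ?y j * A i j)"
    by (rule psd_formD) fact
  also have "\<dots> = (\<Sum>i\<in>S. \<Sum>j\<in>T. ?y i * ?y j * A i j)"
    using assms by (intro sum.mono_neutral_right) auto
  also have "\<dots> = (\<Sum>i\<in>S. \<Sum>j\<in>S. ?y i * ?y j * A i j)"
    using assms by (intro sum.cong sum.mono_neutral_right) auto
  also have "\<dots> = (\<Sum>i\<in>S. \<Sum>j\<in>S. x i * x j * A i j)"
    by (intro sum.cong) auto
  finally show "0 \<le> (\<Sum>i\<in>S. \<Sum>j\<in>S. x i * x j * A i j)" .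
qed

lemma psd_form_diag_nonneg:
  assumes "psd_form S A" "s \<in> S" "finite S"
  shows "0 \<le> A s s"
proof -
  have "psd_form {s} A"
    using psd_form_subset[OF assms(1)] assms by auto
  from psd_formD[OF this, of "\<lambda>_. 1"] show ?thesis by simp
qed

text \<open>Otherwise the form would be affine and nonconstant in the \<open>s\<close>-th coordinate, hence unbounded below.
In \<open>psd_form_Schur_complement\<close> this makes the pivot \<open>A s s = 0\<close> harmless.\<close>
lemma psd_form_zero_diag:
  assumes psd: "psd_form S A" and S: "s \<in> S" "j \<in> S" "finite S" and zero: "A s s = 0"
  shows "A s j = 0"
proof (cases "j = s")
  case False
  have sub: "psd_form {s, j} A"
    using psd_form_subset[OF psd] S by auto
  then have sym: "A j s = A s j"
    by (rule psd_form_sym) auto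
  have form: "0 \<le> 2 * t * A s j + A j j" for t
  proof -
    let ?x = "\<lambda>i. if i = s then t else 1"
    have "0 \<le> (\<Sum>i\<in>{s, j}. \<Sum>k\<in>{s, j}. ?x i * ?x k * A i k)"
      by (rule psd_formD[OF sub])
    then show ?thesis
      using False sym zero by simp
  qed
  show ?thesis
  proof (rule ccontr)
    assume "A s j \<noteq> 0"
    then show False
      using form[of "- (A j j + 1) / (2 * A s j)"] by (simp add: field_simps)
  qed
qed (use zero in simp)

text \<open>The form of the Schur complement is the minimum of the form of \<open>A\<close> over the \<open>s\<close>-th coordinate. For
\<open>A s s = 0\<close> the quotient is \<open>0\<close>, so the complement is \<open>A\<close> itself and the statement is still true.\<close>
lemma psd_form_Schur_complement:
  assumes "finite S" "s \<notin> S" and psd: "psd_form (insert s S) A"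
  shows "psd_form S (\<lambda>i j. A i j - A s i * A s j / A s s)"
proof (rule psd_formI)
  have sym: "A i j = A j i" if "i \<in> insert s S" "j \<in> insert s S" for i j
    using psd_form_sym[OF psd] that by blast
  then show "A i j - A s i * A s j / A s s = A j i - A s j * A s i / A s s"
    if "i \<in> S" "j \<in> S" for i j
    using that by (simp add: mult.commute)
  fix x :: "'a \<Rightarrow> real"
  define L where "L = (\<Sum>j\<in>S. x j * A s j)"
  let ?Q = "\<Sum>i\<in>S. \<Sum>j\<in>S. x i * x j * A i j"
  let ?x = "x(s := - L / A s s)"
  have "L\<^sup>2 / A s s = (\<Sum>i\<in>S. \<Sum>j\<in>S. x i * x j * (A s i * A s j / A s s))"
    unfolding L_def power2_eq_square sum_product sum_divide_distrib
    by (simp add: ac_simps)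
  then have eq: "(\<Sum>i\<in>S. \<Sum>j\<in>S. x i * x j * (A i j - A s i * A s j / A s s)) = ?Q - L\<^sup>2 / A s s"
    by (simp add: right_diff_distrib sum_subtractf)
  have "0 \<le> (\<Sum>i\<in>insert s S. \<Sum>j\<in>insert s S. ?x i * ?x j * A i j)"
    by (rule psd_formD[OF psd])
  also have "\<dots> = (?x s)\<^sup>2 * A s s + 2 * ?x s * (\<Sum>j\<in>S. ?x j * A s j) + (\<Sum>i\<in>S. \<Sum>j\<in>S. ?x i * ?x j * A i j)"
    by (rule quadratic_form_insert) (use assms sym in auto)
  also have "(\<Sum>j\<in>S. ?x j * A s j) = L"
    unfolding L_def using assms by (intro sum.cong) auto
  also have "(\<Sum>i\<in>S. \<Sum>j\<in>S. ?x i * ?x j * A i j) = ?Q"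
    using assms by (intro sum.cong) auto
  also have "(?x s)\<^sup>2 * A s s + 2 * ?x s * L + ?Q = ?Q - L\<^sup>2 / A s s"
    by (cases "A s s = 0") (auto simp: power2_eq_square field_simps)
  finally show "0 \<le> (\<Sum>i\<in>S. \<Sum>j\<in>S. x i * x j * (A i j - A s i * A s j / A s s))"
    using eq by simp
qed

text \<open>Elimination of the row \<open>s\<close> writes \<open>A\<close> as a rank-one matrix plus a matrix supported on \<open>S\<close>. The product of
\<open>C\<close> with the rank-one part is a diagonal congruence of \<open>C\<close>, and the rest is covered by induction.\<close>
lemma psd_form_Schur_product:
  assumes "finite S" "psd_form S A" "psd_form S C"
  shows "psd_form S (\<lambda>i j. A i j * C i j)"
  using assms
proof (induction S arbitrary: A rule: finite_induct)
  case empty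
  then show ?case by (simp add: psd_form_def)
next
  case (insert s S)
  let ?T = "insert s S"
  define B where "B = (\<lambda>i j. A i j - A s i * A s j / A s s)"
  have sym: "A i j = A j i" if "i \<in> ?T" "j \<in> ?T" for i j
    using psd_form_sym[OF insert.prems(1)] that by blast
  have B0: "B i j = 0" if "i \<in> ?T" "j \<in> ?T" "i = s \<or> j = s" for i j
    using that psd_form_zero_diag[OF insert.prems(1), of s] insert.hyps sym[of i s]
    by (cases "A s s = 0") (auto simp: B_def)
  have BC: "psd_form S (\<lambda>i j. B i j * C i j)"
    unfolding B_def
    by (intro insert.IH psd_form_Schur_complement psd_form_subset[OF insert.prems(2)])
       (use insert in auto)
  show ?case
  proof (rule psd_formI)
    show "A i j * C i j = A j i * C j i" if "i \<in> ?T" "j \<in> ?T" for i j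
      using that sym psd_form_sym[OF insert.prems(2)] by metis
    fix x :: "'a \<Rightarrow> real"
    let ?y = "\<lambda>i. x i * A s i"
    have "(\<Sum>i\<in>?T. \<Sum>j\<in>?T. x i * x j * (A i j * C i j)) =
        (\<Sum>i\<in>?T. \<Sum>j\<in>?T. ?y i * ?y j * C i j) / A s s +
        (\<Sum>i\<in>?T. \<Sum>j\<in>?T. x i * x j * (B i j * C i j))"
      unfolding sum_divide_distrib sum.distrib[symmetric]
      by (intro sum.cong refl) (simp add: B_def algebra_simps)
    also have "(\<Sum>i\<in>?T. \<Sum>j\<in>?T. x i * x j * (B i j * C i j)) =
        (\<Sum>i\<in>S. \<Sum>j\<in>?T. x i * x j * (B i j * C i j))"
      by (rule sum.mono_neutral_right) (use insert.hyps B0 in auto)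
    also have "\<dots> = (\<Sum>i\<in>S. \<Sum>j\<in>S. x i * x j * (B i j * C i j))"
      by (intro sum.cong refl sum.mono_neutral_right) (use insert.hyps B0 in auto)
    finally have eq: "(\<Sum>i\<in>?T. \<Sum>j\<in>?T. x i * x j * (A i j * C i j)) =
        (\<Sum>i\<in>?T. \<Sum>j\<in>?T. ?y i * ?y j * C i j) / A s s +
        (\<Sum>i\<in>S. \<Sum>j\<in>S. x i * x j * (B i j * C i j))" .
    have "0 \<le> (\<Sum>i\<in>?T. \<Sum>j\<in>?T. ?y i * ?y j * C i j)"
      by (rule psd_formD[OF insert.prems(2)])
    moreover have "0 \<le> A s s"
      using psd_form_diag_nonneg[OF insert.prems(1)] insert.hyps by simp
    moreover have "0 \<le> (\<Sum>i\<in>S. \<Sum>j\<in>S. x i * x j * (B i j * C i j))"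
      by (rule psd_formD[OF BC])
    ultimately show "0 \<le> (\<Sum>i\<in>?T. \<Sum>j\<in>?T. x i * x j * (A i j * C i j))"
      unfolding eq by (intro add_nonneg_nonneg divide_nonneg_nonneg)
  qed
qed

lemma psd_form_power:
  assumes "finite S" "psd_form S A"
  shows "psd_form S (\<lambda>i j. A i j ^ k)"
proof (induction k)
  case 0
  have "(\<Sum>i\<in>S. \<Sum>j\<in>S. x i * x j) = (\<Sum>i\<in>S. x i)\<^sup>2" for x :: "'a \<Rightarrow> real"
    by (simp add: power2_eq_square sum_product)
  then show ?case
    by (simp add: psd_form_def)
next
  case (Suc k)
  then show ?case
    using psd_form_Schur_product[OF assms] by simp
qed

lemma psd_form_power_series:
  assumes fin: "finite S" and psd: "psd_form S A" and c: "\<And>k. 0 \<le> c k"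
    and f: "\<And>i j. i \<in> S \<Longrightarrow> j \<in> S \<Longrightarrow> (\<lambda>k. c k * A i j ^ k) sums f (A i j)"
  shows "psd_form S (\<lambda>i j. f (A i j))"
proof (rule psd_formI)
  show "f (A i j) = f (A j i)" if "i \<in> S" "j \<in> S" for i j
    using that psd_form_sym[OF psd] by metis
  fix x :: "'a \<Rightarrow> real"
  have "(\<lambda>k. \<Sum>i\<in>S. \<Sum>j\<in>S. x i * x j * (c k * A i j ^ k)) sums
      (\<Sum>i\<in>S. \<Sum>j\<in>S. x i * x j * f (A i j))"
    by (intro sums_sum sums_mult f)
  moreover have "0 \<le> (\<Sum>i\<in>S. \<Sum>j\<in>S. x i * x j * (c k * A i j ^ k))" for k
  proof -
    have "0 \<le> c k * (\<Sum>i\<in>S. \<Sum>j\<in>S. x i * x j * A i j ^ k)"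
      using psd_form_power[OF fin psd, of k] c by (simp add: psd_form_def)
    then show ?thesis
      by (simp add: sum_distrib_left ac_simps)
  qed
  ultimately show "0 \<le> (\<Sum>i\<in>S. \<Sum>j\<in>S. x i * x j * f (A i j))"
    by (rule sums_le[OF _ sums_zero, rotated])
qed

section \<open>Functions preserving positivity on shifted rank-one matrices\<close>

text \<open>The rank-one condition on \<open>(0, r)\<close>, stated for functions on indices instead of matrices. The end point
is a real number because smoothing shortens the interval.\<close>
definition preserves_shifted_rank_one :: "real \<Rightarrow> (real \<Rightarrow> real) \<Rightarrow> bool" where
  "preserves_shifted_rank_one r f \<longleftrightarrow>
     (\<forall>(n::nat) a u x. 0 \<le> a \<longrightarrow> (\<forall>i<n. \<forall>j<n. 0 < a + u i * u j \<and> a + u i * u j < r) \<longrightarrow>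
        0 \<le> (\<Sum>i<n. \<Sum>j<n. x i * x j * f (a + u i * u j)))"

lemma preserves_shifted_rank_oneD:
  fixes n :: nat
  assumes "preserves_shifted_rank_one r f" "0 \<le> a"
    and "\<And>i j. i < n \<Longrightarrow> j < n \<Longrightarrow> 0 < a + u i * u j \<and> a + u i * u j < r"
  shows "0 \<le> (\<Sum>i<n. \<Sum>j<n. x i * x j * f (a + u i * u j))"
  by (rule assms(1)[unfolded preserves_shifted_rank_one_def, rule_format]) (use assms(2,3) in auto)

lemma preserves_shifted_rank_one_nonneg:
  assumes "preserves_shifted_rank_one r f" "0 < x" "x < r"
  shows "0 \<le> f x"
  using preserves_shifted_rank_oneD[OF assms(1), of 0 "Suc 0" "\<lambda>_. sqrt x" "\<lambda>_. 1"] assms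
  by simp

text \<open>The \<open>2 \<times> 2\<close> case tested on the vector \<open>(1, -1)\<close>. With \<open>t = 0\<close> it gives monotonicity, with \<open>a = 0\<close>
midpoint convexity for the geometric mean.\<close>
lemma preserves_shifted_rank_one_two_points:
  assumes "preserves_shifted_rank_one r f" "0 \<le> a"
    and "a + s\<^sup>2 \<in> {0<..<r}" "a + s * t \<in> {0<..<r}" "a + t\<^sup>2 \<in> {0<..<r}"
  shows "2 * f (a + s * t) \<le> f (a + s\<^sup>2) + f (a + t\<^sup>2)"
proof -
  let ?u = "\<lambda>i::nat. if i = 0 then s else t"
  have "0 \<le> (\<Sum>i<Suc (Suc 0). \<Sum>j<Suc (Suc 0). (-1)^i * (-1)^j * f (a + ?u i * ?u j))"
    using assms(3-5) by (intro preserves_shifted_rank_oneD[OF assms(1,2)]) (auto simp: power2_eq_square mult.commute)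
  then show ?thesis
    by (simp add: power2_eq_square mult.commute)
qed

lemma preserves_shifted_rank_one_mono:
  assumes "preserves_shifted_rank_one r f" "0 < x" "x \<le> y" "y < r"
  shows "f x \<le> f y"
  using preserves_shifted_rank_one_two_points[OF assms(1), of x "sqrt (y - x)" 0] assms(2-4)
  by simp

lemma preserves_shifted_rank_one_geometric_mean:
  assumes "preserves_shifted_rank_one r f" "0 < x" "x < r" "0 < y" "y < r"
  shows "2 * f (sqrt (x * y)) \<le> f x + f y"
proof -
  have "sqrt (x * y) \<le> max x y"
  proof (rule real_le_lsqrt)
    show "x * y \<le> (max x y)\<^sup>2"
      unfolding power2_eq_square using assms by (intro mult_mono) auto
  qed (use assms in auto)
  then show ?thesis
    using preserves_shifted_rank_one_two_points[OF assms(1), of 0 "sqrt x" "sqrt y"] assms(2-)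
    by (auto simp: real_sqrt_mult[symmetric])
qed

text \<open>By monotonicity it is enough to make \<open>f\<close> vary little between two points that enclose \<open>c\<close>. Replacing a
point \<open>x k > c\<close> by its geometric mean with \<open>c\<close> at least halves \<open>f (x k) - f c\<close>, and reflecting it to
\<open>c\<^sup>2 / x k < c\<close> bounds the variation on the left by the one on the right.\<close>
lemma preserves_shifted_rank_one_continuous:
  assumes pres: "preserves_shifted_rank_one r f"
  shows "continuous_on {0<..<r} f"
proof -
  have "isCont f c" if c: "0 < c" "c < r" for c
  proof -
    define x where "x = rec_nat ((c + r) / 2) (\<lambda>_ y. sqrt (c * y))"
    have x0: "x 0 = (c + r) / 2" and xS: "x (Suc k) = sqrt (c * x k)" for k
      by (simp_all add: x_def)
    have x: "c < x k \<and> x k < r" for k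
    proof (induction k)
      case 0
      then show ?case using c by (simp add: x0)
    next
      case (Suc k)
      have "c < sqrt (c * x k)"
        by (rule real_less_rsqrt) (use Suc c in \<open>simp add: power2_eq_square\<close>)
      moreover have "sqrt (c * x k) < sqrt (r * r)"
        unfolding real_sqrt_less_iff by (rule mult_strict_mono) (use Suc c in auto)
      ultimately show ?case using c by (simp add: xS)
    qed
    define d where "d = f (x 0) - f c"
    have d: "f (x k) - f c \<le> d * (1/2) ^ k" for k
    proof (induction k)
      case 0
      then show ?case by (simp add: d_def)
    next
      case (Suc k)
      have "2 * f (x (Suc k)) \<le> f c + f (x k)"
        unfolding xS using preserves_shifted_rank_one_geometric_mean[OF pres] c x[of k] by auto
      then show ?case using Suc by simp
    qed
    have low: "f c - f (c\<^sup>2 / x k) \<le> f (x k) - f c" for k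
    proof -
      have *: "0 < c\<^sup>2 / x k" "c\<^sup>2 / x k < c"
        using x[of k] c by (auto simp: power2_eq_square field_simps)
      have "sqrt (c\<^sup>2 / x k * x k) = c"
        using x[of k] c by simp
      then show ?thesis
        using preserves_shifted_rank_one_geometric_mean[OF pres, of "c\<^sup>2 / x k" "x k"] * x[of k] c
        by simp
    qed
    show "isCont f c"
      unfolding continuous_at_eps_delta
    proof (intro allI impI)
      fix e :: real assume "0 < e"
      have "(\<lambda>k. d * (1/2) ^ k) \<longlonglongrightarrow> d * 0"
        by (intro tendsto_mult tendsto_const LIMSEQ_realpow_zero) auto
      then have "\<forall>\<^sub>F k in sequentially. d * (1/2) ^ k < e"
        using \<open>0 < e\<close> by (auto dest: order_tendstoD)
      then obtain k where k: "d * (1/2) ^ k < e"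
        by (auto simp: eventually_sequentially)
      have *: "0 < c\<^sup>2 / x k" "c\<^sup>2 / x k < c"
        using x[of k] c by (auto simp: power2_eq_square field_simps)
      define \<delta> where "\<delta> = min (x k - c) (c - c\<^sup>2 / x k)"
      have "dist (f y) (f c) < e" if "dist y c < \<delta>" for y
      proof -
        have y: "c\<^sup>2 / x k < y" "y < x k"
          using that by (auto simp: \<delta>_def dist_real_def)
        have "f (c\<^sup>2 / x k) \<le> f y"
          by (rule preserves_shifted_rank_one_mono[OF pres *(1)]) (use y x[of k] in auto)
        moreover have "f y \<le> f (x k)"
          by (rule preserves_shifted_rank_one_mono[OF pres less_trans[OF *(1) y(1)]]) (use y x[of k] in auto)
        ultimately show ?thesis
          using low[of k] d[of k] k by (auto simp: dist_real_def)
      qed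
      moreover have "0 < \<delta>"
        using x[of k] * by (auto simp: \<delta>_def)
      ultimately show "\<exists>\<delta>>0. \<forall>y. dist y c < \<delta> \<longrightarrow> dist (f y) (f c) < e"
        by blast
    qed
  qed
  then show ?thesis
    by (simp add: continuous_on_eq_continuous_at)
qed

section \<open>Forward differences and Steklov integrals\<close>

text \<open>The argument type is general because the same operator, with step \<open>1\<close>, acts on the samples
\<open>nat \<Rightarrow> real\<close> that enter a Bernstein polynomial.\<close>
definition fdiff :: "'a::plus \<Rightarrow> ('a \<Rightarrow> real) \<Rightarrow> 'a \<Rightarrow> real" where
  "fdiff h g = (\<lambda>x. g (x + h) - g x)"

lemma fdiff_power_Suc:
  "(fdiff h ^^ Suc j) g = (\<lambda>x. (fdiff h ^^ j) g (x + h) - (fdiff h ^^ j) g x)"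
  by (simp add: fdiff_def[of h "(fdiff h ^^ j) g"])

lemma fdiff_power_has_derivative:
  assumes "\<And>x. 0 < x \<Longrightarrow> x < r \<Longrightarrow> (g has_real_derivative g' x) (at x)"
    and h: "0 < h" and x: "0 < x" "x < r - real k * h"
  shows "((fdiff h ^^ k) g has_real_derivative (fdiff h ^^ k) g' x) (at x)"
  using x
proof (induction k arbitrary: x)
  case (Suc k)
  have eq: "real (Suc k) * h = real k * h + h"
    by (simp add: algebra_simps)
  have "((fdiff h ^^ k) g has_real_derivative (fdiff h ^^ k) g' (x + h)) (at (x + h))"
    by (rule Suc.IH) (use Suc.prems h eq in auto)
  moreover have "((fdiff h ^^ k) g has_real_derivative (fdiff h ^^ k) g' x) (at x)"
    by (rule Suc.IH) (use Suc.prems h eq in auto)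
  ultimately have "((\<lambda>y. (fdiff h ^^ k) g (y + h) - (fdiff h ^^ k) g y) has_real_derivative
      (fdiff h ^^ k) g' (x + h) - (fdiff h ^^ k) g' x) (at x)"
    by (intro DERIV_diff) (simp_all add: DERIV_shift)
  then show ?case unfolding fdiff_power_Suc .
qed (use assms in simp)

lemma fdiff_power_continuous:
  fixes g :: "real \<Rightarrow> real"
  assumes cont: "continuous_on {0<..<r} g" and h: "0 < h"
  shows "continuous_on {0<..<r - real k * h} ((fdiff h ^^ k) g)"
proof (induction k)
  case (Suc k)
  have eq: "real (Suc k) * h = real k * h + h"
    by (simp add: algebra_simps)
  have "continuous_on {0<..<r - real (Suc k) * h} (\<lambda>x. (fdiff h ^^ k) g (x + h))"
    by (rule continuous_on_compose2[OF Suc]) (use h eq in \<open>auto intro!: continuous_intros\<close>)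
  moreover have "continuous_on {0<..<r - real (Suc k) * h} ((fdiff h ^^ k) g)"
    by (rule continuous_on_subset[OF Suc]) (use h eq in auto)
  ultimately have "continuous_on {0<..<r - real (Suc k) * h}
      (\<lambda>x. (fdiff h ^^ k) g (x + h) - (fdiff h ^^ k) g x)"
    by (rule continuous_on_diff)
  then show ?case unfolding fdiff_power_Suc .
qed (use assms in simp)

text \<open>The difference operator commutes with the derivative, so \<open>\<Delta>\<^sub>h\<^sup>m\<close> applied to a derivative of \<open>f\<close> is
nondecreasing once \<open>\<Delta>\<^sub>h\<^sup>m\<close> of the next derivative is nonnegative. The statement therefore runs over
all derivatives at once.\<close>
lemma higher_derivs_nonneg_imp_fdiff_nonneg:
  assumes D: "\<And>k x. 0 < x \<Longrightarrow> x < r \<Longrightarrow> (deriv ^^ k) f field_differentiable at x"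
    and nonneg: "\<And>k x. 0 < x \<Longrightarrow> x < r \<Longrightarrow> 0 \<le> (deriv ^^ k) f x"
    and h: "0 < h" and a: "0 < a" "a + real m * h < r"
  shows "0 \<le> (fdiff h ^^ m) ((deriv ^^ k) f) a"
  using a
proof (induction m arbitrary: k a)
  case 0
  then show ?case using nonneg by simp
next
  case (Suc m)
  have eq: "real (Suc m) * h = real m * h + h"
    by (simp add: algebra_simps)
  have "(fdiff h ^^ m) ((deriv ^^ k) f) a \<le> (fdiff h ^^ m) ((deriv ^^ k) f) (a + h)"
  proof (rule DERIV_nonneg_imp_nondecreasing[where f = "(fdiff h ^^ m) ((deriv ^^ k) f)"])
    fix y assume y: "a \<le> y" "y \<le> a + h"
    have "((fdiff h ^^ m) ((deriv ^^ k) f) has_real_derivative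
        (fdiff h ^^ m) ((deriv ^^ Suc k) f) y) (at y)"
    proof (rule fdiff_power_has_derivative[where r = r, OF _ h])
      show "((deriv ^^ k) f has_real_derivative (deriv ^^ Suc k) f x) (at x)" if "0 < x" "x < r" for x
        using D[OF that, of k] by (simp add: DERIV_deriv_iff_field_differentiable)
    qed (use y Suc.prems eq in auto)
    moreover have "0 \<le> (fdiff h ^^ m) ((deriv ^^ Suc k) f) y"
      by (rule Suc.IH) (use y Suc.prems eq in auto)
    ultimately show "\<exists>y'. ((fdiff h ^^ m) ((deriv ^^ k) f) has_real_derivative y') (at y) \<and> 0 \<le> y'"
      by blast
  qed (use h in simp)
  then show ?case unfolding fdiff_power_Suc by simp
qed

definition steklov :: "real \<Rightarrow> (real \<Rightarrow> real) \<Rightarrow> real \<Rightarrow> real" where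
  "steklov h g = (\<lambda>x. integral {x..x + h} g)"

lemma steklov_has_derivative:
  assumes cont: "continuous_on {0<..<r} g" and h: "0 < h" and x: "0 < x" "x < r - h"
  shows "(steklov h g has_real_derivative fdiff h g x) (at x)"
proof -
  define l u where "l = x / 2" and "u = (x + h + r) / 2"
  have lu: "0 < l" "l < x" "x + h < u" "u < r"
    using x h by (auto simp: l_def u_def)
  have cont': "continuous_on {l..u} g"
    by (rule continuous_on_subset[OF cont]) (use lu in auto)
  have D: "((\<lambda>y. integral {l..y} g) has_real_derivative g t) (at t)" if "l < t" "t < u" for t
    using integral_has_real_derivative[OF cont', of t] that at_within_Icc_at[of l t u] by simp
  have "((\<lambda>y. integral {l..y + h} g - integral {l..y} g) has_real_derivative g (x + h) - g x) (at x)"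
    by (intro DERIV_diff DERIV_shift[THEN iffD1] D) (use lu h in auto)
  moreover have "\<forall>\<^sub>F y in nhds x. integral {l..y + h} g - integral {l..y} g = steklov h g y"
  proof -
    have "\<forall>\<^sub>F y in nhds x. y \<in> {l<..<u - h}"
      using lu by (intro eventually_nhds_in_open) auto
    then show ?thesis
    proof eventually_elim
      case (elim y)
      have "g integrable_on {l..y + h}"
        by (intro integrable_continuous_real continuous_on_subset[OF cont']) (use elim in auto)
      then have "integral {l..y} g + integral {y..y + h} g = integral {l..y + h} g"
        by (rule Henstock_Kurzweil_Integration.integral_combine[rotated 2]) (use elim h in auto)
      then show ?case by (simp add: steklov_def)
    qed
  qed
  ultimately show ?thesis
    unfolding fdiff_def by (subst (asm) DERIV_cong_ev[OF refl _ refl])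
qed

lemma steklov_continuous:
  assumes "continuous_on {0<..<r} g" "0 < h"
  shows "continuous_on {0<..<r - h} (steklov h g)"
proof (rule DERIV_continuous_on)
  fix x assume "x \<in> {0<..<r - h}"
  then have "(steklov h g has_real_derivative fdiff h g x) (at x)"
    by (intro steklov_has_derivative[OF assms]) auto
  then show "(steklov h g has_real_derivative fdiff h g x) (at x within {0<..<r - h})"
    by (rule has_field_derivative_at_within)
qed

text \<open>Positivity is preserved because the translates \<open>x \<mapsto> g (s + x)\<close> with \<open>s \<ge> 0\<close> satisfy the condition with \<open>a\<close>
replaced by \<open>a + s\<close>, and the integral over \<open>s\<close> is linear.\<close>
lemma steklov_preserves:
  assumes cont: "continuous_on {0<..<r} g" and h: "0 < h"
    and pres: "preserves_shifted_rank_one r g"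
  shows "preserves_shifted_rank_one (r - h) (steklov h g)"
  unfolding preserves_shifted_rank_one_def
proof (intro allI impI)
  fix n :: nat and a :: real and u x :: "nat \<Rightarrow> real"
  assume a: "0 \<le> a" and u: "\<forall>i<n. \<forall>j<n. 0 < a + u i * u j \<and> a + u i * u j < r - h"
  have int: "(\<lambda>s. g (s + (a + u i * u j))) integrable_on {0..h}" if "i < n" "j < n" for i j
  proof (rule integrable_continuous_real, rule continuous_on_compose2[OF cont])
    have "0 < a + u i * u j" "a + u i * u j < r - h"
      using u that by auto
    then show "(\<lambda>s. s + (a + u i * u j)) ` {0..h} \<subseteq> {0<..<r}"
      by auto
  qed (intro continuous_intros)
  have "(\<Sum>i<n. \<Sum>j<n. x i * x j * steklov h g (a + u i * u j)) =
      (\<Sum>i<n. \<Sum>j<n. integral {0..h} (\<lambda>s. x i * x j * g (s + (a + u i * u j))))"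
    using integral_shift_real_ivl[of "a + u i * u j" "a + u i * u j" "a + u i * u j + h" g for i j]
    by (simp add: steklov_def add.commute)
  also have "\<dots> = (\<Sum>i<n. integral {0..h} (\<lambda>s. \<Sum>j<n. x i * x j * g (s + (a + u i * u j))))"
    by (intro sum.cong refl integral_sum[symmetric]) (auto intro!: integrable_on_mult_right int)
  also have "\<dots> = integral {0..h} (\<lambda>s. \<Sum>i<n. \<Sum>j<n. x i * x j * g (s + (a + u i * u j)))"
    by (intro integral_sum[symmetric]) (auto intro!: integrable_sum integrable_on_mult_right int)
  also have "\<dots> \<ge> 0"
  proof (rule integral_nonneg)
    show "(\<lambda>s. \<Sum>i<n. \<Sum>j<n. x i * x j * g (s + (a + u i * u j))) integrable_on {0..h}"
      by (auto intro!: integrable_sum integrable_on_mult_right int)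
    fix s assume s: "s \<in> {0..h}"
    have "0 \<le> (\<Sum>i<n. \<Sum>j<n. x i * x j * g ((s + a) + u i * u j))"
    proof (rule preserves_shifted_rank_oneD[OF pres])
      fix i j assume "i < n" "j < n"
      then have "0 < a + u i * u j" "a + u i * u j < r - h"
        using u by auto
      then show "0 < s + a + u i * u j \<and> s + a + u i * u j < r"
        using s by auto
    qed (use a s in auto)
    then show "0 \<le> (\<Sum>i<n. \<Sum>j<n. x i * x j * g (s + (a + u i * u j)))"
      by (simp add: add.assoc)
  qed
  finally show "0 \<le> (\<Sum>i<n. \<Sum>j<n. x i * x j * steklov h g (a + u i * u j))" .
qed

lemma steklov_power:
  assumes "continuous_on {0<..<r} g" "0 < h" "preserves_shifted_rank_one r g"
  shows "continuous_on {0<..<r - real k * h} ((steklov h ^^ k) g) \<and>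
    preserves_shifted_rank_one (r - real k * h) ((steklov h ^^ k) g)"
proof (induction k)
  case (Suc k)
  then show ?case
    using steklov_continuous[of "r - real k * h" "(steklov h ^^ k) g" h]
      steklov_preserves[of "r - real k * h" "(steklov h ^^ k) g" h] assms(2)
    by (simp add: algebra_simps)
qed (use assms in simp)

section \<open>Forward differences from the rank-one condition\<close>

text \<open>Up to sign these are alternating binomial coefficients. In the induction a difference of shifted
copies of \<open>x\<close> turns the \<open>k\<close>-th moment into a combination of lower ones, so one more moment vanishes. The
nodes start at \<open>1\<close> so that all products of nodes are positive, as needed to apply Taylor's theorem to the right of \<open>a\<close>.\<close>
lemma moment_annihilating_vector:
  "\<exists>x :: nat \<Rightarrow> real. (\<forall>k<m. (\<Sum>i<Suc m. x i * real (Suc i) ^ k) = 0) \<and>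
     (\<Sum>i<Suc m. x i * real (Suc i) ^ m) \<noteq> 0"
proof (induction m)
  case 0
  show ?case by (intro exI[of _ "\<lambda>_. 1"]) simp
next
  case (Suc m)
  then obtain x :: "nat \<Rightarrow> real" where
    x: "\<And>k. k < m \<Longrightarrow> (\<Sum>i<Suc m. x i * real (Suc i) ^ k) = 0"
      "(\<Sum>i<Suc m. x i * real (Suc i) ^ m) \<noteq> 0"
    by blast
  define M where "M = (\<lambda>k. \<Sum>i<Suc m. x i * real (Suc i) ^ k)"
  define y where "y = (\<lambda>i. (if i = 0 then 0 else x (i - 1)) - (if i = Suc m then 0 else x i))"
  have y: "(\<Sum>i<Suc (Suc m). y i * real (Suc i) ^ k) = (\<Sum>l<k. real (k choose l) * M l)" for k
  proof -
    have "(\<Sum>i<Suc (Suc m). y i * real (Suc i) ^ k) =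
        (\<Sum>i<Suc (Suc m). (if i = 0 then 0 else x (i - 1)) * real (Suc i) ^ k) -
        (\<Sum>i<Suc (Suc m). (if i = Suc m then 0 else x i) * real (Suc i) ^ k)"
      unfolding y_def left_diff_distrib sum_subtractf ..
    also have "(\<Sum>i<Suc (Suc m). (if i = 0 then 0 else x (i - 1)) * real (Suc i) ^ k) =
        (\<Sum>i<Suc m. x i * (real (Suc i) + 1) ^ k)"
      by (subst sum.lessThan_Suc_shift) (simp add: add.commute)
    also have "(\<Sum>i<Suc (Suc m). (if i = Suc m then 0 else x i) * real (Suc i) ^ k) =
        (\<Sum>i<Suc m. x i * real (Suc i) ^ k)"
      by (subst sum.lessThan_Suc) (simp del: sum.lessThan_Suc)
    also have "(\<Sum>i<Suc m. x i * (real (Suc i) + 1) ^ k) - (\<Sum>i<Suc m. x i * real (Suc i) ^ k) =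
        (\<Sum>i<Suc m. \<Sum>l<k. real (k choose l) * (x i * real (Suc i) ^ l))"
      unfolding sum_subtractf[symmetric] binomial_ring
      by (intro sum.cong refl)
         (simp add: lessThan_Suc_atMost[symmetric] sum_distrib_left distrib_left algebra_simps)
    also have "\<dots> = (\<Sum>l<k. real (k choose l) * M l)"
      unfolding M_def sum_distrib_left by (rule sum.swap)
    finally show ?thesis .
  qed
  have M: "M l = 0" if "l < m" for l
    using x(1)[OF that] by (simp add: M_def)
  show ?case
  proof (intro exI[of _ y] conjI allI impI)
    fix k assume "k < Suc m"
    then show "(\<Sum>i<Suc (Suc m). y i * real (Suc i) ^ k) = 0"
      unfolding y using M by (intro sum.neutral) auto
  next
    have "(\<Sum>l<Suc m. real (Suc m choose l) * M l) = real (Suc m) * M m"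
      unfolding sum.lessThan_Suc[of _ m] using M by (simp add: sum.neutral)
    also have "\<dots> \<noteq> 0"
      using x(2) unfolding M_def mult_eq_0_iff by simp
    finally show "(\<Sum>i<Suc (Suc m). y i * real (Suc i) ^ Suc m) \<noteq> 0"
      unfolding y .
  qed
qed

text \<open>Only \<open>m\<close> derivatives are assumed, so the expansion uses the Lagrange remainder, and continuity of the last
derivative lets its intermediate points tend to \<open>a\<close>. The family \<open>G\<close> replaces iterated \<open>deriv\<close> because
the derivatives of a Steklov integral are known explicitly.\<close>
lemma preserves_shifted_rank_one_top_derivative_nonneg:
  fixes G :: "nat \<Rightarrow> real \<Rightarrow> real"
  assumes pres: "preserves_shifted_rank_one r (G 0)"
    and D: "\<And>k x. k < m \<Longrightarrow> 0 < x \<Longrightarrow> x < r \<Longrightarrow> (G k has_real_derivative G (Suc k) x) (at x)"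
    and cont: "continuous_on {0<..<r} (G m)" and a: "0 < a" "a < r"
  shows "0 \<le> G m a"
proof (cases "m = 0")
  case True
  then show ?thesis using preserves_shifted_rank_one_nonneg[OF pres a] by simp
next
  case False
  obtain x :: "nat \<Rightarrow> real" where
    x0: "\<And>k. k < m \<Longrightarrow> (\<Sum>i<Suc m. x i * real (Suc i) ^ k) = 0" and
    xm: "(\<Sum>i<Suc m. x i * real (Suc i) ^ m) \<noteq> 0"
    using moment_annihilating_vector by blast
  define w where "w = (\<lambda>i j. real (Suc i) * real (Suc j))"
  \<comment> \<open>The nodes are at most \<open>m + 1\<close>, so this radius keeps all points \<open>a + \<delta> N * w i j\<close> below \<open>r\<close>.\<close>
  define \<rho> where "\<rho> = (r - a) / (2 * (real (Suc m))\<^sup>2)"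
  define \<delta> where "\<delta> = (\<lambda>N. \<rho> * inverse (real (Suc N)))"
  have \<rho>: "0 < \<rho>" "\<rho> * (real (Suc m))\<^sup>2 < r - a"
    using a by (auto simp: \<rho>_def)
  have \<delta>: "0 < \<delta> N" "\<delta> N \<le> \<rho>" for N
    using \<rho> by (auto simp: \<delta>_def field_simps)
  have w: "0 < w i j" "a + \<delta> N * w i j < r" if "i < Suc m" "j < Suc m" for i j N
  proof -
    show "0 < w i j" by (simp add: w_def)
    have "w i j \<le> (real (Suc m))\<^sup>2"
      unfolding w_def power2_eq_square using that by (intro mult_mono) auto
    then have "\<delta> N * w i j \<le> \<rho> * (real (Suc m))\<^sup>2"
      using \<delta>[of N] \<open>0 < w i j\<close> \<rho> by (intro mult_mono) auto
    then show "a + \<delta> N * w i j < r" using \<rho> by simp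
  qed
  define P where "P = (\<lambda>N i j \<xi>. a < \<xi> \<and> \<xi> < a + \<delta> N * w i j \<and> G 0 (a + \<delta> N * w i j) =
      (\<Sum>k<m. G k a / fact k * (\<delta> N * w i j) ^ k) + G m \<xi> / fact m * (\<delta> N * w i j) ^ m)"
  have P_ex: "\<exists>\<xi>. P N i j \<xi>" if ij: "i < Suc m" "j < Suc m" for N i j
  proof -
    have less: "a < a + \<delta> N * w i j"
      using w(1)[OF ij] \<delta>(1)[of N] by simp
    have "\<exists>\<xi>>a. \<xi> < a + \<delta> N * w i j \<and> G 0 (a + \<delta> N * w i j) =
      (\<Sum>k<m. G k a / fact k * (a + \<delta> N * w i j - a) ^ k) + G m \<xi> / fact m * (a + \<delta> N * w i j - a) ^ m"
    proof (rule Taylor_up[where a = a])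
      show "\<forall>k t. k < m \<and> a \<le> t \<and> t \<le> a + \<delta> N * w i j \<longrightarrow> (G k has_real_derivative G (Suc k) t) (at t)"
        using D a(1) w(2)[OF ij, of N] by (meson less_le_trans le_less_trans)
    qed (use less False in auto)
    then show ?thesis by (simp add: P_def)
  qed
  define \<xi> where "\<xi> = (\<lambda>N i j. SOME \<xi>. P N i j \<xi>)"
  have P\<xi>: "P N i j (\<xi> N i j)" if "i < Suc m" "j < Suc m" for N i j
    unfolding \<xi>_def using P_ex[OF that] by (rule someI_ex)
  then have \<xi>: "a < \<xi> N i j" "\<xi> N i j < a + \<delta> N * w i j"
    "G 0 (a + \<delta> N * w i j) =
      (\<Sum>k<m. G k a / fact k * (\<delta> N * w i j) ^ k) + G m (\<xi> N i j) / fact m * (\<delta> N * w i j) ^ m"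
    if "i < Suc m" "j < Suc m" for N i j
    unfolding P_def using that by blast+
  define T where "T = (\<lambda>N. \<Sum>i<Suc m. \<Sum>j<Suc m. x i * x j * w i j ^ m * G m (\<xi> N i j))"
  have pw: "(\<Sum>i<Suc m. \<Sum>j<Suc m. x i * x j * w i j ^ k) = (\<Sum>i<Suc m. x i * real (Suc i) ^ k)\<^sup>2" for k
    unfolding power2_eq_square sum_product w_def power_mult_distrib
    by (intro sum.cong refl) (simp add: ac_simps)
  have T: "0 \<le> T N" for N
  proof -
    have \<delta>w: "\<delta> N * w i j = (sqrt (\<delta> N) * real (Suc i)) * (sqrt (\<delta> N) * real (Suc j))" for i j
    proof -
      have "\<delta> N * w i j = (sqrt (\<delta> N) * sqrt (\<delta> N)) * w i j"
        using \<delta>(1)[of N] by simp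
      then show ?thesis
        unfolding w_def by (simp only: ac_simps)
    qed
    have "0 \<le> (\<Sum>i<Suc m. \<Sum>j<Suc m. x i * x j * G 0 (a + \<delta> N * w i j))"
      unfolding \<delta>w
    proof (rule preserves_shifted_rank_oneD[OF pres])
      show "0 < a + sqrt (\<delta> N) * real (Suc i) * (sqrt (\<delta> N) * real (Suc j)) \<and>
        a + sqrt (\<delta> N) * real (Suc i) * (sqrt (\<delta> N) * real (Suc j)) < r"
        if "i < Suc m" "j < Suc m" for i j
        unfolding \<delta>w[symmetric] using w[OF that] \<delta>(1)[of N] a by (simp add: add_pos_pos)
    qed (use a in simp)
    also have "\<dots> = (\<Sum>i<Suc m. \<Sum>j<Suc m.
        (\<Sum>k<m. G k a / fact k * \<delta> N ^ k * (x i * x j * w i j ^ k)) +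
        \<delta> N ^ m / fact m * (x i * x j * w i j ^ m * G m (\<xi> N i j)))"
    proof (intro sum.cong refl)
      fix i j assume "i \<in> {..<Suc m}" "j \<in> {..<Suc m}"
      then have ij: "i < Suc m" "j < Suc m" by auto
      show "x i * x j * G 0 (a + \<delta> N * w i j) =
        (\<Sum>k<m. G k a / fact k * \<delta> N ^ k * (x i * x j * w i j ^ k)) +
        \<delta> N ^ m / fact m * (x i * x j * w i j ^ m * G m (\<xi> N i j))"
        unfolding \<xi>(3)[OF ij] distrib_left sum_distrib_left
        by (intro arg_cong2[where f = "(+)"] sum.cong refl) (simp_all add: power_mult_distrib)
    qed
    also have "\<dots> = (\<Sum>i<Suc m. \<Sum>j<Suc m. \<Sum>k<m. G k a / fact k * \<delta> N ^ k * (x i * x j * w i j ^ k)) +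
        \<delta> N ^ m / fact m * T N"
      unfolding sum.distrib T_def sum_distrib_left ..
    also have "(\<Sum>i<Suc m. \<Sum>j<Suc m. \<Sum>k<m. G k a / fact k * \<delta> N ^ k * (x i * x j * w i j ^ k)) =
        (\<Sum>i<Suc m. \<Sum>k<m. \<Sum>j<Suc m. G k a / fact k * \<delta> N ^ k * (x i * x j * w i j ^ k))"
      by (intro sum.cong refl sum.swap)
    also have "\<dots> = (\<Sum>k<m. \<Sum>i<Suc m. \<Sum>j<Suc m. G k a / fact k * \<delta> N ^ k * (x i * x j * w i j ^ k))"
      by (rule sum.swap)
    also have "\<dots> = (\<Sum>k<m. G k a / fact k * \<delta> N ^ k * (\<Sum>i<Suc m. \<Sum>j<Suc m. x i * x j * w i j ^ k))"
      unfolding sum_distrib_left ..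
    \<comment> \<open>All terms below order \<open>m\<close> contain a vanishing moment; only the remainder is left.\<close>
    also have "\<dots> = 0"
      unfolding pw using x0 by (intro sum.neutral) simp
    finally have "0 \<le> \<delta> N ^ m / fact m * T N"
      by (simp only: add_0)
    moreover have "0 < \<delta> N ^ m / fact m"
      using \<delta>(1)[of N] by simp
    ultimately show ?thesis
      by (simp only: zero_le_mult_iff) linarith
  qed
  have \<delta>0: "\<delta> \<longlonglongrightarrow> 0"
    unfolding \<delta>_def using LIMSEQ_inverse_real_of_nat by (rule tendsto_mult_right_zero)
  have "(\<lambda>N. G m (\<xi> N i j)) \<longlonglongrightarrow> G m a" if "i < Suc m" "j < Suc m" for i j
  proof (rule isCont_tendsto_compose[where g = "G m"])
    show "isCont (G m) a"
      using cont a by (simp add: continuous_on_eq_continuous_at)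
    have "(\<lambda>N. a + \<delta> N * w i j) \<longlonglongrightarrow> a + 0 * w i j"
      by (intro tendsto_intros \<delta>0)
    then show "(\<lambda>N. \<xi> N i j) \<longlonglongrightarrow> a"
      by (intro tendsto_sandwich[OF _ _ tendsto_const, of a "\<lambda>N. \<xi> N i j"])
         (auto intro!: always_eventually less_imp_le \<xi> that)
  qed
  then have "T \<longlonglongrightarrow> (\<Sum>i<Suc m. \<Sum>j<Suc m. x i * x j * w i j ^ m * G m a)"
    unfolding T_def by (intro tendsto_sum tendsto_mult tendsto_const) auto
  then have "0 \<le> (\<Sum>i<Suc m. \<Sum>j<Suc m. x i * x j * w i j ^ m * G m a)"
    using T by (intro LIMSEQ_le_const) auto
  also have "\<dots> = (\<Sum>i<Suc m. x i * real (Suc i) ^ m)\<^sup>2 * G m a"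
    unfolding pw[symmetric] sum_distrib_right ..
  finally show ?thesis
    using xm by (simp add: zero_le_mult_iff del: sum.lessThan_Suc)
qed

lemma preserves_shifted_rank_one_fdiff_nonneg:
  assumes pres: "preserves_shifted_rank_one r f"
    and h: "0 < h" and a: "0 < a" "a + real m * h < r"
  shows "0 \<le> (fdiff h ^^ m) f a"
proof -
  note cont = preserves_shifted_rank_one_continuous[OF pres]
  \<comment> \<open>Differentiation turns one Steklov integral into one difference operator.\<close>
  define G where "G = (\<lambda>k. (fdiff h ^^ k) ((steklov h ^^ (m - k)) f))"
  have "0 \<le> G m a"
  proof (rule preserves_shifted_rank_one_top_derivative_nonneg[of "r - real m * h" G])
    show "preserves_shifted_rank_one (r - real m * h) (G 0)"
      using steklov_power[OF cont h pres] by (simp add: G_def)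
    show "continuous_on {0<..<r - real m * h} (G m)"
      using fdiff_power_continuous[OF cont h] by (simp add: G_def)
    fix k x assume k: "k < m" and x: "0 < x" "x < r - real m * h"
    define g where "g = (steklov h ^^ (m - Suc k)) f"
    have g: "(steklov h ^^ (m - k)) f = steklov h g"
      using k by (simp add: g_def Suc_diff_Suc flip: funpow.simps(2) comp_apply[of "steklov h"])
    have "continuous_on {0<..<r - real (m - Suc k) * h} g"
      using steklov_power[OF cont h pres] by (simp add: g_def)
    then have "(steklov h g has_real_derivative fdiff h g y) (at y)"
      if "0 < y" "y < r - real (m - k) * h" for y
      using that h k by (intro steklov_has_derivative) (auto simp: of_nat_diff algebra_simps)
    then have "((fdiff h ^^ k) (steklov h g) has_real_derivative (fdiff h ^^ k) (fdiff h g) x) (at x)"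
      by (rule fdiff_power_has_derivative[where r = "r - real (m - k) * h"]) (use h x k in \<open>auto simp: of_nat_diff algebra_simps\<close>)
    then show "(G k has_real_derivative G (Suc k) x) (at x)"
      by (simp add: G_def g flip: g_def add: funpow_swap1)
  qed (use a in auto)
  then show ?thesis by (simp add: G_def)
qed

section \<open>Power series from nonnegative forward differences\<close>

text \<open>The de Casteljau recursion: a consequence of Pascal's rule for the binomial coefficients.\<close>
lemma Bernstein_sum_Suc:
  fixes F :: "nat \<Rightarrow> real"
  shows "(\<Sum>k\<le>Suc n. F k * Bernstein (Suc n) k x) =
    (1 - x) * (\<Sum>k\<le>n. F k * Bernstein n k x) + x * (\<Sum>k\<le>n. F (Suc k) * Bernstein n k x)"
proof -
  have *: "F (Suc k) * Bernstein (Suc n) (Suc k) x =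
      x * (F (Suc k) * Bernstein n k x) +
      F (Suc k) * (real (n choose Suc k) * x ^ Suc k * (1 - x) ^ (n - k))" for k
    by (simp add: Bernstein_def algebra_simps)
  have "(\<Sum>k\<le>Suc n. F k * Bernstein (Suc n) k x) =
      F 0 * (1 - x) ^ Suc n + (\<Sum>k\<le>n. F (Suc k) * Bernstein (Suc n) (Suc k) x)"
    by (subst sum.atMost_Suc_shift) (simp add: Bernstein_def)
  also have "\<dots> = x * (\<Sum>k\<le>n. F (Suc k) * Bernstein n k x) + (F 0 * (1 - x) ^ Suc n +
      (\<Sum>k\<le>n. F (Suc k) * (real (n choose Suc k) * x ^ Suc k * (1 - x) ^ (n - k))))"
    unfolding * sum.distrib sum_distrib_left by simp
  also have "F 0 * (1 - x) ^ Suc n +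
      (\<Sum>k\<le>n. F (Suc k) * (real (n choose Suc k) * x ^ Suc k * (1 - x) ^ (n - k))) =
      (\<Sum>k\<le>Suc n. F k * (real (n choose k) * x ^ k * (1 - x) ^ (Suc n - k)))"
    by (simp add: sum.atMost_Suc_shift del: sum.atMost_Suc)
  also have "\<dots> = (\<Sum>k\<le>n. F k * (real (n choose k) * x ^ k * (1 - x) ^ (Suc n - k)))"
    by simp
  also have "\<dots> = (1 - x) * (\<Sum>k\<le>n. F k * Bernstein n k x)"
    unfolding sum_distrib_left Bernstein_def
    by (intro sum.cong refl) (simp add: Suc_diff_le ac_simps)
  finally show ?thesis by simp
qed

text \<open>The recursion reads \<open>B\<^sub>n\<^sub>+\<^sub>1 F = B\<^sub>n F + x B\<^sub>n (\<Delta>F)\<close>, where \<open>B\<^sub>n\<close> is the Bernstein sum. Hence nonnegative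
coefficients propagate as long as all differences of \<open>F\<close> are nonnegative.\<close>
lemma Bernstein_sum_eq_nonneg_poly:
  fixes F :: "nat \<Rightarrow> real"
  assumes "\<And>i j. i + j \<le> n \<Longrightarrow> 0 \<le> (fdiff 1 ^^ j) F i"
  shows "\<exists>p. (\<forall>k. 0 \<le> coeff p k) \<and> (\<forall>x. poly p x = (\<Sum>k\<le>n. F k * Bernstein n k x))"
  using assms
proof (induction n arbitrary: F)
  case 0
  have "0 \<le> F 0"
    using "0.prems"[of 0 0] by simp
  then show ?case
    by (intro exI[of _ "[:F 0:]"]) (auto simp: Bernstein_def coeff_pCons split: nat.split)
next
  case (Suc n)
  obtain p where p: "\<And>k. 0 \<le> coeff p k" "\<And>x. poly p x = (\<Sum>k\<le>n. F k * Bernstein n k x)"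
    using Suc.IH[of F] Suc.prems by auto
  have "0 \<le> (fdiff 1 ^^ j) (fdiff 1 F) i" if "i + j \<le> n" for i j
    using Suc.prems[of i "Suc j"] that by (simp add: funpow_swap1)
  then obtain q where q: "\<And>k. 0 \<le> coeff q k"
    "\<And>x. poly q x = (\<Sum>k\<le>n. fdiff 1 F k * Bernstein n k x)"
    using Suc.IH[of "fdiff 1 F"] by auto
  show ?case
  proof (intro exI[of _ "p + pCons 0 q"] conjI allI)
    show "0 \<le> coeff (p + pCons 0 q) k" for k
      using p(1) q(1) by (auto simp: coeff_pCons split: nat.split)
    show "poly (p + pCons 0 q) x = (\<Sum>k\<le>Suc n. F k * Bernstein (Suc n) k x)" for x
      unfolding Bernstein_sum_Suc
      by (simp add: p(2) q(2) fdiff_def sum_subtractf left_diff_distrib algebra_simps)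
  qed
qed

text \<open>With nonnegative coefficients the value at \<open>1\<close> bounds every coefficient, uniformly in \<open>n\<close>. Compactness
gives a coefficientwise convergent subsequence, and the geometric series dominates the sums at
\<open>x < 1\<close>, so Tannery's theorem applies.\<close>
lemma nonneg_poly_limit_is_power_series:
  fixes p :: "nat \<Rightarrow> real poly"
  assumes coeff: "\<And>n k. 0 \<le> coeff (p n) k"
    and lim: "\<And>x. 0 < x \<Longrightarrow> x \<le> 1 \<Longrightarrow> (\<lambda>n. poly (p n) x) \<longlonglongrightarrow> f x"
  shows "\<exists>c. (\<forall>k. 0 \<le> c k) \<and> (\<forall>x. 0 < x \<longrightarrow> x < 1 \<longrightarrow> (\<lambda>k. c k * x ^ k) sums f x)"
proof -
  have "Bseq (\<lambda>n. poly (p n) 1)"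
    using lim[of 1] by (intro convergent_imp_Bseq convergentI) auto
  then obtain M where M: "\<And>n. poly (p n) 1 \<le> M"
    by (auto simp: Bseq_def abs_le_iff)
  have le: "coeff (p n) k \<le> M" for n k
  proof (cases "k \<le> degree (p n)")
    case True
    then have "coeff (p n) k \<le> poly (p n) 1"
      unfolding poly_altdef using coeff by (auto intro!: member_le_sum)
    then show ?thesis using M[of n] by simp
  next
    case False
    have "0 \<le> poly (p n) 1"
      unfolding poly_altdef using coeff by (auto intro!: sum_nonneg)
    then show ?thesis
      using False M[of n] by (simp add: coeff_eq_0)
  qed
  obtain s where s: "strict_mono (s :: nat \<Rightarrow> nat)"
    "\<And>k. k \<in> UNIV \<Longrightarrow> \<exists>l. (\<lambda>n. coeff (p (s n)) k) \<longlonglongrightarrow> l"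
    using function_convergent_subsequence[of "UNIV :: nat set" "\<lambda>n k. coeff (p n) k" M]
      le coeff by auto
  define c where "c = (\<lambda>k. lim (\<lambda>n. coeff (p (s n)) k))"
  have c: "(\<lambda>n. coeff (p (s n)) k) \<longlonglongrightarrow> c k" for k
    using s(2)[of k] unfolding c_def by (auto simp: convergent_LIMSEQ_iff[symmetric] convergent_def)
  have "(\<lambda>k. c k * x ^ k) sums f x" if x: "0 < x" "x < 1" for x
  proof -
    have "summable (\<lambda>k. M * x ^ k)"
      using x by (intro summable_mult summable_geometric) auto
    moreover have "(\<lambda>n. coeff (p (s n)) k * x ^ k) \<longlonglongrightarrow> c k * x ^ k" for k
      by (intro tendsto_mult c tendsto_const)
    moreover have "\<forall>\<^sub>F (k, n) in at_top \<times>\<^sub>F sequentially. norm (coeff (p (s n)) k * x ^ k) \<le> M * x ^ k"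
      using le coeff x by (intro always_eventually) (auto simp: abs_mult intro!: mult_right_mono)
    ultimately have "summable (\<lambda>k. norm (c k * x ^ k))"
      and T: "(\<lambda>n. \<Sum>k. coeff (p (s n)) k * x ^ k) \<longlonglongrightarrow> (\<Sum>k. c k * x ^ k)"
      using tannerys_theorem[of "\<lambda>k n. coeff (p (s n)) k * x ^ k" "\<lambda>k. c k * x ^ k" sequentially "\<lambda>k. M * x ^ k"]
      by auto
    have "(\<Sum>k. coeff (p n) k * x ^ k) = poly (p n) x" for n
      unfolding poly_altdef by (rule suminf_finite) (auto simp: coeff_eq_0)
    then have "(\<lambda>n. poly (p (s n)) x) \<longlonglongrightarrow> (\<Sum>k. c k * x ^ k)"
      using T by simp
    moreover have "(\<lambda>n. poly (p (s n)) x) \<longlonglongrightarrow> f x"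
      using LIMSEQ_subseq_LIMSEQ[OF lim[of x] s(1)] x by (simp add: o_def)
    ultimately have "f x = (\<Sum>k. c k * x ^ k)"
      using LIMSEQ_unique by blast
    with \<open>summable (\<lambda>k. norm (c k * x ^ k))\<close> show ?thesis
      by (simp add: summable_norm_cancel summable_sums)
  qed
  moreover have "0 \<le> c k" for k
    using c[of k] coeff by (intro LIMSEQ_le_const) auto
  ultimately show ?thesis by blast
qed

lemma fdiff_power_sample:
  fixes f :: "real \<Rightarrow> real"
  shows "(fdiff 1 ^^ j) (\<lambda>i. f (a + real i * h)) i = (fdiff h ^^ j) f (a + real i * h)"
proof (induction j arbitrary: i)
  case (Suc j)
  have eq: "a + real (i + 1) * h = a + real i * h + h"
    by (simp add: algebra_simps)
  show ?case
    unfolding fdiff_power_Suc Suc eq ..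
qed simp

text \<open>The unit interval is mapped to \<open>[\<epsilon> n, \<epsilon> n + b]\<close> instead of \<open>[0, b]\<close>, because \<open>f\<close> is not controlled at \<open>0\<close>.
Since \<open>\<epsilon> n\<close> tends to \<open>0\<close>, continuity of \<open>f\<close> makes the Bernstein polynomials of these translates converge to \<open>f (b * y)\<close>.\<close>
lemma fdiff_nonneg_imp_power_series:
  assumes cont: "continuous_on {0<..<r} f"
    and fdiff: "\<And>h a j. 0 < h \<Longrightarrow> 0 < a \<Longrightarrow> a + real j * h < r \<Longrightarrow> 0 \<le> (fdiff h ^^ j) f a"
    and b: "0 < b" "b < r"
  shows "\<exists>c. (\<forall>k. 0 \<le> c k) \<and> (\<forall>x. 0 < x \<longrightarrow> x < b \<longrightarrow> (\<lambda>k. c k * x ^ k) sums f x)"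
proof -
  define \<epsilon> where "\<epsilon> = (\<lambda>n. (r - b) / 2 * inverse (real (Suc n)))"
  have \<epsilon>: "0 < \<epsilon> n" "\<epsilon> n + b < r" for n
  proof -
    show "0 < \<epsilon> n" using b by (simp add: \<epsilon>_def)
    have "\<epsilon> n \<le> (r - b) / 2 * 1"
      unfolding \<epsilon>_def using b by (intro mult_left_mono) (auto simp: field_simps)
    then show "\<epsilon> n + b < r" using b by simp
  qed
  have "\<forall>n. \<exists>p. (\<forall>k. 0 \<le> coeff p k) \<and>
      (\<forall>y. 0 \<le> y \<longrightarrow> y \<le> 1 \<longrightarrow> \<bar>f (\<epsilon> n + b * y) - poly p y\<bar> < inverse (real (Suc n)))"
  proof
    fix n
    have cont_n: "continuous_on {0..1} (\<lambda>y. f (\<epsilon> n + b * y))"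
    proof (rule continuous_on_compose2[OF cont])
      have "0 < \<epsilon> n + b * y \<and> \<epsilon> n + b * y < r" if "0 \<le> y" "y \<le> 1" for y
      proof -
        have "b * y \<le> b * 1" "0 \<le> b * y" using b that by (auto intro: mult_left_mono)
        then show ?thesis using \<epsilon>[of n] by auto
      qed
      then show "(\<lambda>y. \<epsilon> n + b * y) ` {0..1} \<subseteq> {0<..<r}" by auto
    qed (intro continuous_intros)
    have "0 < inverse (real (Suc n))"
      by simp
    from Bernstein_Weierstrass[OF cont_n this] obtain N0 where N0: "\<forall>N y. N0 \<le> N \<and> y \<in> {0..1} \<longrightarrow>
        \<bar>f (\<epsilon> n + b * y) - (\<Sum>k\<le>N. f (\<epsilon> n + b * (real k / real N)) * Bernstein N k y)\<bar> < inverse (real (Suc n))"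
      by (rule exE)
    have N: "\<bar>f (\<epsilon> n + b * y) - (\<Sum>k\<le>Suc N0. f (\<epsilon> n + b * (real k / real (Suc N0))) * Bernstein (Suc N0) k y)\<bar>
        < inverse (real (Suc n))" if "0 \<le> y" "y \<le> 1" for y
      by (rule N0[rule_format]) (use that in auto)
    define h where "h = b / real (Suc N0)"
    have h: "0 < h" "real (Suc N0) * h = b" using b by (auto simp: h_def)
    have h': "b * (real k / real (Suc N0)) = real k * h" for k by (simp add: h_def)
    have "0 \<le> (fdiff 1 ^^ j) (\<lambda>k. f (\<epsilon> n + real k * h)) i" if "i + j \<le> Suc N0" for i j
      unfolding fdiff_power_sample
    proof (rule fdiff[OF h(1)])
      show "0 < \<epsilon> n + real i * h" using \<epsilon>(1)[of n] h by (intro add_pos_nonneg) auto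
      have "real (i + j) * h \<le> real (Suc N0) * h"
        using that h(1) by (intro mult_right_mono) auto
      then have "real i * h + real j * h \<le> b"
        using h(2) by (simp add: distrib_right)
      then show "\<epsilon> n + real i * h + real j * h < r" using \<epsilon>(2)[of n] by simp
    qed
    from Bernstein_sum_eq_nonneg_poly[OF this]
    obtain p where "\<forall>k. 0 \<le> coeff p k"
      "\<And>y. poly p y = (\<Sum>k\<le>Suc N0. f (\<epsilon> n + real k * h) * Bernstein (Suc N0) k y)"
      by blast
    then show "\<exists>p. (\<forall>k. 0 \<le> coeff p k) \<and>
      (\<forall>y. 0 \<le> y \<longrightarrow> y \<le> 1 \<longrightarrow> \<bar>f (\<epsilon> n + b * y) - poly p y\<bar> < inverse (real (Suc n)))"
      using N unfolding h' by (intro exI[of _ p]) simp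
  qed
  from choice[OF this] obtain p where p: "\<And>n k. 0 \<le> coeff (p n) k"
    "\<And>n y. 0 \<le> y \<Longrightarrow> y \<le> 1 \<Longrightarrow> \<bar>f (\<epsilon> n + b * y) - poly (p n) y\<bar> < inverse (real (Suc n))"
    by blast
  have \<epsilon>0: "\<epsilon> \<longlonglongrightarrow> 0"
    unfolding \<epsilon>_def using LIMSEQ_inverse_real_of_nat by (rule tendsto_mult_right_zero)
  have lim: "(\<lambda>n. poly (p n) y) \<longlonglongrightarrow> f (b * y)" if y: "0 < y" "y \<le> 1" for y
  proof -
    have "b * y \<le> b"
      using b y by (simp add: mult_left_le)
    then have "b * y < r"
      using b by linarith
    moreover have "0 < b * y"
      using b y by simp
    ultimately have "isCont f (b * y)"
      using cont by (simp add: continuous_on_eq_continuous_at)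
    moreover have "(\<lambda>n. \<epsilon> n + b * y) \<longlonglongrightarrow> b * y"
      using tendsto_add[OF \<epsilon>0 tendsto_const[of "b * y"]] by simp
    ultimately have 1: "(\<lambda>n. f (\<epsilon> n + b * y)) \<longlonglongrightarrow> f (b * y)"
      by (rule isCont_tendsto_compose)
    have "(\<lambda>n. f (\<epsilon> n + b * y) - poly (p n) y) \<longlonglongrightarrow> 0"
      using LIMSEQ_inverse_real_of_nat
      by (rule Lim_null_comparison[rotated]) (use p(2) y in \<open>auto intro!: always_eventually less_imp_le\<close>)
    from tendsto_diff[OF 1 this] show ?thesis by simp
  qed
  obtain c where c: "\<And>k. 0 \<le> c k" "\<And>y. 0 < y \<Longrightarrow> y < 1 \<Longrightarrow> (\<lambda>k. c k * y ^ k) sums f (b * y)"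
    using nonneg_poly_limit_is_power_series[OF p(1) lim] by blast
  show ?thesis
  proof (intro exI[of _ "\<lambda>k. c k / b ^ k"] conjI allI impI)
    show "0 \<le> c k / b ^ k" for k using c(1) b by simp
    show "(\<lambda>k. c k / b ^ k * x ^ k) sums f x" if "0 < x" "x < b" for x
      using c(2)[of "x / b"] that b by (simp add: power_divide)
  qed
qed

lemma power_series_higher_derivs:
  fixes f :: "real \<Rightarrow> real"
  assumes c: "\<And>k. 0 \<le> c k"
    and f: "\<And>x. 0 < x \<Longrightarrow> x < b \<Longrightarrow> (\<lambda>k. c k * x ^ k) sums f x"
    and x: "0 < x" "x < b"
  shows "0 \<le> (deriv ^^ n) f x \<and> (deriv ^^ n) f field_differentiable at x"
proof -
  have D: "\<exists>d. (\<forall>k. 0 \<le> d k) \<and> (\<forall>x. 0 < x \<longrightarrow> x < b \<longrightarrow>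
      (\<lambda>k. d k * x ^ k) sums g' x \<and> (g has_real_derivative g' x) (at x))"
    if "\<And>k. 0 \<le> c k" "\<And>x. 0 < x \<Longrightarrow> x < b \<Longrightarrow> (\<lambda>k. c k * x ^ k) sums g x" "g' = deriv g" for c g g'
  proof -
    have "(\<lambda>k. diffs c k * x ^ k) sums deriv g x \<and> (g has_real_derivative deriv g x) (at x)"
      if x: "0 < x" "x < b" for x
    proof -
      obtain K where K: "x < K" "K < b" using dense x by blast
      then have sm: "summable (\<lambda>k. c k * K ^ k)"
        using that x by (intro sums_summable) (auto intro: \<open>\<And>x. 0 < x \<Longrightarrow> x < b \<Longrightarrow> (\<lambda>k. c k * x ^ k) sums g x\<close>)
      have "((\<lambda>x. \<Sum>k. c k * x ^ k) has_real_derivative (\<Sum>k. diffs c k * x ^ k)) (at x)"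
        using sm by (rule termdiffs_strong) (use x K in auto)
      moreover have "\<forall>\<^sub>F y in nhds x. (\<Sum>k. c k * y ^ k) = g y"
      proof -
        have "\<forall>\<^sub>F y in nhds x. y \<in> {0<..<b}"
          using x by (intro eventually_nhds_in_open) auto
        then show ?thesis
          by eventually_elim (use \<open>\<And>x. 0 < x \<Longrightarrow> x < b \<Longrightarrow> (\<lambda>k. c k * x ^ k) sums g x\<close> in \<open>auto simp: sums_iff\<close>)
      qed
      ultimately have *: "(g has_real_derivative (\<Sum>k. diffs c k * x ^ k)) (at x)"
        by (subst (asm) DERIV_cong_ev[OF refl _ refl])
      moreover have "summable (\<lambda>k. diffs c k * x ^ k)"
        by (rule termdiff_converges[of _ K])
           (use x K in \<open>auto intro!: powser_inside[OF sm]\<close>)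
      ultimately show ?thesis
        using DERIV_imp_deriv[OF *] by (simp add: summable_sums)
    qed
    then show ?thesis
      using that(1,3) by (intro exI[of _ "diffs c"]) (auto simp: diffs_def)
  qed
  have "\<exists>d. (\<forall>k. 0 \<le> d k) \<and> (\<forall>x. 0 < x \<longrightarrow> x < b \<longrightarrow> (\<lambda>k. d k * x ^ k) sums (deriv ^^ n) f x)" for n
  proof (induction n)
    case 0
    then show ?case using c f by auto
  next
    case (Suc n)
    then obtain d where "\<And>k. 0 \<le> d k"
      "\<And>x. 0 < x \<Longrightarrow> x < b \<Longrightarrow> (\<lambda>k. d k * x ^ k) sums (deriv ^^ n) f x"
      by blast
    from D[OF this, of "(deriv ^^ Suc n) f"] show ?case by auto
  qed
  then obtain d where d: "\<And>k. 0 \<le> d k"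
    "\<And>x. 0 < x \<Longrightarrow> x < b \<Longrightarrow> (\<lambda>k. d k * x ^ k) sums (deriv ^^ n) f x"
    by blast
  have "0 \<le> (deriv ^^ n) f x"
    by (rule sums_le[OF _ sums_zero d(2)[OF x]]) (use d(1) x in auto)
  moreover have "((deriv ^^ n) f has_real_derivative deriv ((deriv ^^ n) f) x) (at x)"
    using D[OF d refl] x by auto
  ultimately show ?thesis
    by (auto simp: field_differentiable_def)
qed

section \<open>Matrices and the equivalence\<close>

lemma scalar_prod_mult_mat_vec:
  fixes A :: "real mat"
  assumes "A \<in> carrier_mat n n" "x \<in> carrier_vec n"
  shows "scalar_prod x (A *\<^sub>v x) = (\<Sum>i<n. \<Sum>j<n. x $ i * x $ j * A $$ (i, j))"
  using assms
  by (auto simp: scalar_prod_def lessThan_atLeast0 sum_distrib_left ac_simps intro!: sum.cong)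

lemma psd_mats_iff:
  "A \<in> psd_mats n J \<longleftrightarrow> A \<in> carrier_mat n n \<and> psd_form {..<n} (\<lambda>i j. A $$ (i, j)) \<and>
     (\<forall>i<n. \<forall>j<n. A $$ (i, j) \<in> J)"
proof (cases "A \<in> carrier_mat n n")
  case True
  have 1: "transpose_mat A = A \<longleftrightarrow> (\<forall>i<n. \<forall>j<n. A $$ (i, j) = A $$ (j, i))"
  proof
    assume *: "transpose_mat A = A"
    show "\<forall>i<n. \<forall>j<n. A $$ (i, j) = A $$ (j, i)"
    proof (intro allI impI)
      fix i j assume "i < n" "j < n"
      then have "transpose_mat A $$ (i, j) = A $$ (j, i)"
        using True by simp
      then show "A $$ (i, j) = A $$ (j, i)" by (simp only: *)
    qed
  next
    assume "\<forall>i<n. \<forall>j<n. A $$ (i, j) = A $$ (j, i)"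
    then show "transpose_mat A = A"
      using True by (intro eq_matI) auto
  qed
  have 2: "(\<forall>x\<in>carrier_vec n. 0 \<le> scalar_prod x (A *\<^sub>v x)) \<longleftrightarrow>
      (\<forall>x. 0 \<le> (\<Sum>i<n. \<Sum>j<n. x i * x j * A $$ (i, j)))"
  proof
    assume *: "\<forall>x\<in>carrier_vec n. 0 \<le> scalar_prod x (A *\<^sub>v x)"
    show "\<forall>x. 0 \<le> (\<Sum>i<n. \<Sum>j<n. x i * x j * A $$ (i, j))"
    proof
      fix x :: "nat \<Rightarrow> real"
      have "0 \<le> scalar_prod (vec n x) (A *\<^sub>v vec n x)"
        using * by simp
      also have "\<dots> = (\<Sum>i<n. \<Sum>j<n. x i * x j * A $$ (i, j))"
        by (simp add: scalar_prod_mult_mat_vec[OF True])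
      finally show "0 \<le> (\<Sum>i<n. \<Sum>j<n. x i * x j * A $$ (i, j))" .
    qed
  next
    assume "\<forall>x. 0 \<le> (\<Sum>i<n. \<Sum>j<n. x i * x j * A $$ (i, j))"
    then show "\<forall>x\<in>carrier_vec n. 0 \<le> scalar_prod x (A *\<^sub>v x)"
      by (auto simp: scalar_prod_mult_mat_vec[OF True])
  qed
  have 3: "elements_mat A \<subseteq> J \<longleftrightarrow> (\<forall>i<n. \<forall>j<n. A $$ (i, j) \<in> J)"
    using True by (auto simp: elements_mat_def UN_subset_iff image_subset_iff)
  show ?thesis
    unfolding psd_mats_def psd_form_def Ball_def lessThan_iff using True 1 2 3 by auto
qed (auto simp: psd_mats_def)

lemma shifted_rank_one_mat:
  assumes "u \<in> carrier_vec n"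
  shows "a \<cdot>\<^sub>m ones_mat n + outer_self u \<in> carrier_mat n n"
    and "i < n \<Longrightarrow> j < n \<Longrightarrow> (a \<cdot>\<^sub>m ones_mat n + outer_self u) $$ (i, j) = a + u $ i * u $ j"
  using assms
  by (auto simp: ones_mat_def outer_self_def scalar_prod_def mat_of_cols_index)

lemma shifted_rank_one_psd_mats:
  assumes u: "u \<in> carrier_vec n" and "0 \<le> a"
    and I: "\<And>i j. i < n \<Longrightarrow> j < n \<Longrightarrow> a + u $ i * u $ j \<in> I"
  shows "a \<cdot>\<^sub>m ones_mat n + outer_self u \<in> psd_mats n I"
  unfolding psd_mats_iff
proof (intro conjI allI impI psd_formI)
  fix x :: "nat \<Rightarrow> real"
  have "(\<Sum>i<n. \<Sum>j<n. x i * x j * (a + u $ i * u $ j)) =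
      a * (\<Sum>i<n. \<Sum>j<n. x i * x j) + (\<Sum>i<n. \<Sum>j<n. (x i * u $ i) * (x j * u $ j))"
    unfolding sum_distrib_left sum.distrib[symmetric]
    by (intro sum.cong refl) (simp add: algebra_simps)
  also have "\<dots> = a * (\<Sum>i<n. x i)\<^sup>2 + (\<Sum>i<n. x i * u $ i)\<^sup>2"
    by (simp only: power2_eq_square sum_product)
  finally have "0 \<le> (\<Sum>i<n. \<Sum>j<n. x i * x j * (a + u $ i * u $ j))"
    using \<open>0 \<le> a\<close> by simp
  also have "\<dots> = (\<Sum>i<n. \<Sum>j<n. x i * x j * (a \<cdot>\<^sub>m ones_mat n + outer_self u) $$ (i, j))"
    by (intro sum.cong refl) (simp add: shifted_rank_one_mat(2)[OF u])
  finally show "0 \<le> (\<Sum>i<n. \<Sum>j<n. x i * x j * (a \<cdot>\<^sub>m ones_mat n + outer_self u) $$ (i, j))" .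
qed (use I in \<open>auto simp: shifted_rank_one_mat[OF u] simp del: index_add_mat\<close>)

text \<open>The coefficients may depend on the bound \<open>b\<close>. This spares a uniqueness argument: a matrix has finitely
many entries and differentiability is local, so one bound at a time is enough.\<close>
definition local_power_series_on :: "real set \<Rightarrow> (real \<Rightarrow> real) \<Rightarrow> bool" where
  "local_power_series_on I f \<longleftrightarrow> (\<forall>b\<in>I. \<exists>c. (\<forall>k. 0 \<le> c k) \<and>
     (\<forall>x. 0 < x \<longrightarrow> x < b \<longrightarrow> (\<lambda>k. c k * x ^ k) sums f x))"

lemma initial_interval_open:
  assumes "I = {x. 0 < x \<and> ereal x < R}"
  shows "open I"
proof -
  have "I = {0<..} \<inter> ereal -` {..<R}"
    using assms by auto
  moreover have "open (ereal -` {..<R})"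
    by (intro open_vimage continuous_intros)
  ultimately show ?thesis by auto
qed

lemma initial_interval_larger:
  assumes "I = {x. 0 < x \<and> ereal x < R}" "b \<in> I"
  obtains r where "r \<in> I" "b < r"
proof -
  obtain r where "ereal b < ereal r" "ereal r < R"
    using ereal_dense2[of "ereal b" R] assms by auto
  then show ?thesis
    using assms by (intro that[of r]) auto
qed

text \<open>The condition is used on \<open>(0, r)\<close> for a real \<open>r\<close> between \<open>b\<close> and \<open>R\<close>, which leaves room for the shrinking
intervals also when \<open>R\<close> is infinite.\<close>
lemma preserves_imp_local_power_series:
  assumes I: "I = {x. 0 < x \<and> ereal x < R}"
    and pres: "\<And>n a u. n \<ge> 1 \<Longrightarrow> u \<in> carrier_vec n \<Longrightarrow> 0 \<le> a \<Longrightarrow> ereal a < R \<Longrightarrow>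
      (\<And>i j. i < n \<Longrightarrow> j < n \<Longrightarrow> a + u $ i * u $ j \<in> I) \<Longrightarrow>
      map_mat f (a \<cdot>\<^sub>m ones_mat n + outer_self u) \<in> psd_mats n UNIV"
  shows "local_power_series_on I f"
  unfolding local_power_series_on_def
proof
  fix b assume b: "b \<in> I"
  then obtain r where r: "r \<in> I" "b < r"
    using initial_interval_larger[OF I] by blast
  have less_R: "ereal x < R" if "x < r" for x
  proof -
    have "ereal x < ereal r" using that by simp
    also have "\<dots> < R" using r I by simp
    finally show ?thesis .
  qed
  have "preserves_shifted_rank_one r f"
    unfolding preserves_shifted_rank_one_def
  proof (intro allI impI)
    fix n :: nat and a :: real and u x :: "nat \<Rightarrow> real"
    assume a: "0 \<le> a" and u: "\<forall>i<n. \<forall>j<n. 0 < a + u i * u j \<and> a + u i * u j < r"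
    let ?u = "vec n u"
    show "0 \<le> (\<Sum>i<n. \<Sum>j<n. x i * x j * f (a + u i * u j))"
    proof (cases "n = 0")
      case False
      have "a + u 0 * u 0 < r"
        using u False by simp
      moreover have "0 \<le> u 0 * u 0"
        by simp
      ultimately have "ereal a < R"
        by (intro less_R) linarith
      moreover have "a + ?u $ i * ?u $ j \<in> I" if "i < n" "j < n" for i j
        using that u less_R by (simp add: I)
      ultimately have "map_mat f (a \<cdot>\<^sub>m ones_mat n + outer_self ?u) \<in> psd_mats n UNIV"
        using False a by (intro pres) auto
      then have "psd_form {..<n} (\<lambda>i j. map_mat f (a \<cdot>\<^sub>m ones_mat n + outer_self ?u) $$ (i, j))"
        by (simp add: psd_mats_iff)
      then have "0 \<le> (\<Sum>i<n. \<Sum>j<n. x i * x j * map_mat f (a \<cdot>\<^sub>m ones_mat n + outer_self ?u) $$ (i, j))"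
        by (rule psd_formD)
      also have "\<dots> = (\<Sum>i<n. \<Sum>j<n. x i * x j * f (a + u i * u j))"
      proof (intro sum.cong refl)
        fix i j assume "i \<in> {..<n}" "j \<in> {..<n}"
        then have ij: "i < n" "j < n" by auto
        have "map_mat f (a \<cdot>\<^sub>m ones_mat n + outer_self ?u) $$ (i, j) =
            f ((a \<cdot>\<^sub>m ones_mat n + outer_self ?u) $$ (i, j))"
          using shifted_rank_one_mat(1)[of ?u n a] ij by (intro index_map_mat) auto
        also have "\<dots> = f (a + u i * u j)"
          using ij by (simp add: shifted_rank_one_mat(2) del: index_add_mat)
        finally show "x i * x j * map_mat f (a \<cdot>\<^sub>m ones_mat n + outer_self ?u) $$ (i, j) =
            x i * x j * f (a + u i * u j)"
          by simp
      qed
      finally show ?thesis .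
    qed simp
  qed
  then show "\<exists>c. (\<forall>k. 0 \<le> c k) \<and> (\<forall>x. 0 < x \<longrightarrow> x < b \<longrightarrow> (\<lambda>k. c k * x ^ k) sums f x)"
    using b r I
    by (intro fdiff_nonneg_imp_power_series[of r] preserves_shifted_rank_one_continuous
          preserves_shifted_rank_one_fdiff_nonneg) auto
qed

lemma local_power_series_imp_psd:
  assumes I: "I = {x. 0 < x \<and> ereal x < R}" and f: "local_power_series_on I f"
    and n: "n \<ge> 1" and A: "A \<in> psd_mats n I"
  shows "map_mat f A \<in> psd_mats n UNIV"
proof -
  let ?E = "(\<lambda>(i, j). A $$ (i, j)) ` ({..<n} \<times> {..<n})"
  have fin: "finite ?E" "?E \<noteq> {}"
    using n by (auto simp: lessThan_empty_iff)
  have "Max ?E \<in> ?E"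
    by (rule Max_in[OF fin])
  moreover have "?E \<subseteq> I"
    using A by (auto simp: psd_mats_iff)
  ultimately obtain b where b: "b \<in> I" "Max ?E < b"
    using initial_interval_larger[OF I, of "Max ?E"] by blast
  have entry: "0 < A $$ (i, j)" "A $$ (i, j) < b" if "i < n" "j < n" for i j
  proof -
    show "0 < A $$ (i, j)"
      using A that by (auto simp: psd_mats_iff I)
    have "A $$ (i, j) \<le> Max ?E"
      using fin that by (intro Max_ge) auto
    then show "A $$ (i, j) < b"
      using b by simp
  qed
  obtain c where c: "\<And>k. 0 \<le> c k" "\<And>x. 0 < x \<Longrightarrow> x < b \<Longrightarrow> (\<lambda>k. c k * x ^ k) sums f x"
    using f b(1) unfolding local_power_series_on_def by blast
  have psd: "psd_form {..<n} (\<lambda>i j. A $$ (i, j))" and carrier: "A \<in> carrier_mat n n"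
    using A by (simp_all add: psd_mats_iff)
  have "psd_form {..<n} (\<lambda>i j. f (A $$ (i, j)))"
  proof (rule psd_form_power_series[OF finite_lessThan psd, where c = c])
    show "(\<lambda>k. c k * A $$ (i, j) ^ k) sums f (A $$ (i, j))" if "i \<in> {..<n}" "j \<in> {..<n}" for i j
      using that by (intro c(2) entry) auto
  qed (rule c(1))
  also have "?this \<longleftrightarrow> psd_form {..<n} (\<lambda>i j. map_mat f A $$ (i, j))"
    by (rule psd_form_cong) (use carrier in simp)
  finally show ?thesis
    using carrier by (simp add: psd_mats_iff)
qed

lemma local_power_series_imp_absolutely_monotonic:
  assumes I: "I = {x. 0 < x \<and> ereal x < R}" and f: "local_power_series_on I f"
  shows "absolutely_monotonic_on I f"
proof -
  have D: "0 \<le> (deriv ^^ k) f x \<and> (deriv ^^ k) f field_differentiable at x" if x: "x \<in> I" for k x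
  proof -
    obtain b where b: "b \<in> I" "x < b"
      using initial_interval_larger[OF I x] by blast
    then obtain c where "\<And>k. 0 \<le> c k" "\<And>x. 0 < x \<Longrightarrow> x < b \<Longrightarrow> (\<lambda>k. c k * x ^ k) sums f x"
      using f unfolding local_power_series_on_def by blast
    then show ?thesis
      by (rule power_series_higher_derivs) (use x b I in auto)
  qed
  have "isCont f x" if "x \<in> I" for x
    using D[OF that, of 0] field_differentiable_imp_continuous_at by auto
  then have "continuous_on I f"
    by (simp add: continuous_at_imp_continuous_on)
  then show ?thesis
    using D by (simp add: absolutely_monotonic_on_def smooth_on_open_def
      interior_open[OF initial_interval_open[OF I]])
qed

lemma absolutely_monotonic_imp_local_power_series:
  assumes I: "I = {x. 0 < x \<and> ereal x < R}" and f: "absolutely_monotonic_on I f"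
  shows "local_power_series_on I f"
  unfolding local_power_series_on_def
proof
  fix b assume b: "b \<in> I"
  then obtain r where r: "r \<in> I" "b < r"
    using initial_interval_larger[OF I] by blast
  have sub: "x \<in> I" if "0 < x" "x < r" for x
  proof -
    have "ereal x < ereal r" using that by simp
    also have "\<dots> < R" using r I by simp
    finally show ?thesis using that I by simp
  qed
  show "\<exists>c. (\<forall>k. 0 \<le> c k) \<and> (\<forall>x. 0 < x \<longrightarrow> x < b \<longrightarrow> (\<lambda>k. c k * x ^ k) sums f x)"
  proof (rule fdiff_nonneg_imp_power_series)
    show "continuous_on {0<..<r} f"
      using f sub unfolding absolutely_monotonic_on_def
      by (auto elim!: continuous_on_subset)
    show "0 \<le> (fdiff h ^^ j) f a" if "0 < h" "0 < a" "a + real j * h < r" for h a j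
      using higher_derivs_nonneg_imp_fdiff_nonneg[of r f h a j 0] that f sub
      by (simp add: absolutely_monotonic_on_def smooth_on_open_def
          interior_open[OF initial_interval_open[OF I]])
  qed (use b r I in auto)
qed

theorem theorem3:
  fixes R :: ereal and I :: "real set" and f :: "real \<Rightarrow> real"
  assumes "0 < R"
    and "I = {x. 0 < x \<and> ereal x < R}"
  shows
    "((\<forall>n::nat. n \<ge> 1 \<longrightarrow> (\<forall>a::real. \<forall>u \<in> carrier_vec n.
        0 \<le> a \<and> ereal a < R \<and> (\<forall>i < n. \<forall>j < n. a + u $ i * u $ j \<in> I) \<longrightarrow>
        map_mat f (a \<cdot>\<^sub>m ones_mat n + outer_self u) \<in> psd_mats n UNIV))
      \<longleftrightarrow>
      (\<forall>n::nat. n \<ge> 1 \<longrightarrow> (\<forall>A \<in> psd_mats n I. map_mat f A \<in> psd_mats n UNIV)))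
     \<and>
     ((\<forall>n::nat. n \<ge> 1 \<longrightarrow> (\<forall>A \<in> psd_mats n I. map_mat f A \<in> psd_mats n UNIV))
      \<longleftrightarrow>
      absolutely_monotonic_on I f)"
    (is "(?rank_one \<longleftrightarrow> ?psd) \<and> (?psd \<longleftrightarrow> ?abs_mono)")
proof -
  have "?rank_one" if ?psd
    using that shifted_rank_one_psd_mats[of _ _ _ I] by blast
  moreover have "local_power_series_on I f" if ?rank_one
    by (rule preserves_imp_local_power_series[OF assms(2)]) (use that in blast)
  moreover have "local_power_series_on I f" if ?abs_mono
    using absolutely_monotonic_imp_local_power_series[OF assms(2) that] .
  moreover have ?psd if "local_power_series_on I f"
    using local_power_series_imp_psd[OF assms(2) that] by blast
  moreover have ?abs_mono if "local_power_series_on I f"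
    using local_power_series_imp_absolutely_monotonic[OF assms(2) that] .
  ultimately show ?thesis by argo
qed

end
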